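(* There exist $\tilde p<1$ and $\kappa>1$ such that, for every $p$ with $\tilde p\le p<1$, every $c\ge1$ and every box $\Lambda$ satisfying $|\Lambda|>3^{6d}$, $$P_p\Big(\exists e\in\mathcal P,\ d\big(e,\Lambda^c\cup(\mathcal P\setminus\{e\})\big)\ge\kappa c\ln|\Lambda|\ \Big|\ T\text{ and }B\text{ are not connected}\Big)\le\frac1{|\Lambda|^c}.$$
   Context: Fix an integer $d\ge 2$. $\mathbb E^d$ is the set of pairs $\{x,y\}$ of points of $\mathbb Z^d$ at Euclidean distance $1$; an edge is identified with the corresponding closed unit segment. $\Lambda$ is a closed cubic box of positive side length in $\mathbb R^d$, centred at the origin, with sides parallel to the axes and corners in $\mathbb Z^d$; $|\Lambda|$ is the cardinality of $\Lambda\cap\mathbb Z^d$; $\Lambda^c=\mathbb R^d\setminus\Lambda$; $T$ and $B$ are the top and bottom sides (faces) of $\Lambda$. A configuration is a map $\omega$ from the set of edges included in $\Lambda$ to $\{0,1\}$; $e$ is open if $\omega(e)=1$, closed if $\omega(e)=0$. $T\overset{\omega}{\longleftrightarrow}B$ ($T$ and $B$ are connected) means that a path of open edges joins a vertex of $T$ to a vertex of $B$. $P_p$ is the Bernoulli product measure on configurations in which each edge is open with probability $p$, $0<p<1$. $\omega^e$ is the configuration obtained from $\omega$ by opening $e$, and $\mathcal P=\mathcal P(\omega)=\{e\subset\Lambda:T\overset{\omega^e}{\longleftrightarrow}B\}$ is the set of pivotal edges of $\omega$. $d(\cdot,\cdot)$ is Euclidean distance (between sets, the infimum), a set of edges being viewed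 as the union of its segments; $d$ alone is the dimension. The constants depend only on $d$. *)

theory Defs
  imports "HOL-Probability.Probability"
begin

text \<open>The dimension \<open>d\<close> is \<open>CARD('n)\<close>, so that \<open>real ^ 'n\<close> is Euclidean \<open>d\<close>-space.\<close>

definition lattice_points :: "(real ^ 'n) set" where
  "lattice_points = {x. \<forall>i. x $ i \<in> \<int>}"

definition lattice_edges :: "(real ^ 'n) set set" where
  "lattice_edges = {{x, y} | x y. x \<in> lattice_points \<and> y \<in> lattice_points \<and> dist x y = 1}"

text \<open>An edge is a pair of endpoints; the segment identified with it is its convex hull.\<close>

definition segment :: "(real ^ 'n) set \<Rightarrow> (real ^ 'n) set" where
  "segment e = convex hull e"

text \<open>A closed cube with sides parallel to the axes, centred at the origin and with corners in the
  integer lattice is \<open>[-m, m]\<^sup>d\<close> with \<open>m\<close> a natural number; its side length \<open>2 m\<close> is positive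
  iff \<open>m \<ge> 1\<close>.\<close>

definition box_of :: "nat \<Rightarrow> (real ^ 'n) set" where
  "box_of m = cbox (\<chi> i. - real m) (\<chi> i. real m)"

definition box_card :: "'n::finite itself \<Rightarrow> nat \<Rightarrow> nat" where
  "box_card _ m = card (box_of m \<inter> (lattice_points :: (real ^ 'n) set))"

text \<open>The coordinate \<open>v\<close> is the vertical one.\<close>

definition top_side :: "'n::finite \<Rightarrow> nat \<Rightarrow> (real ^ 'n) set" where
  "top_side v m = {x \<in> box_of m. x $ v = real m}"

definition bottom_side :: "'n::finite \<Rightarrow> nat \<Rightarrow> (real ^ 'n) set" where
  "bottom_side v m = {x \<in> box_of m. x $ v = - real m}"

definition box_edges :: "nat \<Rightarrow> (real ^ 'n) set set" where
  "box_edges m = {e \<in> lattice_edges. segment e \<subseteq> box_of m}"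

text \<open>A configuration assigns \<open>True\<close> to open and \<open>False\<close> to closed edges. It is a total function,
  but only its values on \<open>box_edges m\<close> are ever used.\<close>

type_synonym 'n configuration = "(real ^ 'n) set \<Rightarrow> bool"

definition open_path :: "nat \<Rightarrow> 'n::finite configuration \<Rightarrow> (real ^ 'n) list \<Rightarrow> bool" where
  "open_path m \<omega> xs \<longleftrightarrow> xs \<noteq> [] \<and> set xs \<subseteq> lattice_points \<and>
     successively (\<lambda>x y. {x, y} \<in> box_edges m \<and> \<omega> {x, y}) xs"

definition top_bottom_connected :: "'n::finite \<Rightarrow> nat \<Rightarrow> 'n configuration \<Rightarrow> bool" where
  "top_bottom_connected v m \<omega> \<longleftrightarrow>
     (\<exists>xs. open_path m \<omega> xs \<and> hd xs \<in> top_side v m \<and> last xs \<in> bottom_side v m)"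

definition pivotal_edges :: "'n::finite \<Rightarrow> nat \<Rightarrow> 'n configuration \<Rightarrow> (real ^ 'n) set set" where
  "pivotal_edges v m \<omega> = {e \<in> box_edges m. top_bottom_connected v m (fun_upd \<omega> e True)}"

lemma finite_box_lattice: "finite (box_of m \<inter> (lattice_points :: (real ^ 'n) set))"
proof -
  let ?S = "of_int ` {- int m..int m} :: real set"
  have "box_of m \<inter> (lattice_points :: (real ^ 'n) set) \<subseteq> vec_lambda ` (UNIV \<rightarrow>\<^sub>E ?S)"
  proof
    fix x :: "real ^ 'n" assume x: "x \<in> box_of m \<inter> lattice_points"
    have "x $ i \<in> ?S" for i
    proof -
      obtain k where k: "x $ i = of_int k"
        using x by (auto simp: lattice_points_def elim: Ints_cases)
      have "- real m \<le> x $ i" "x $ i \<le> real m"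
        using x by (auto simp: box_of_def mem_box_cart)
      then have "k \<in> {- int m..int m}" unfolding k by auto
      then show ?thesis using k by blast
    qed
    then have "vec_nth x \<in> UNIV \<rightarrow>\<^sub>E ?S" by auto
    then show "x \<in> vec_lambda ` (UNIV \<rightarrow>\<^sub>E ?S)"
      by (metis image_eqI vec_nth_inverse)
  qed
  moreover have "finite ((UNIV :: 'n set) \<rightarrow>\<^sub>E ?S)" by (intro finite_PiE) auto
  ultimately show ?thesis by (meson finite_imageI finite_subset)
qed

text \<open>\<open>Pi_pmf\<close> is the product measure only over a finite index set.\<close>

lemma finite_box_edges: "finite (box_edges m :: (real ^ 'n) set set)"
proof (rule finite_subset)
  show "box_edges m \<subseteq> Pow (box_of m \<inter> (lattice_points :: (real ^ 'n) set))"
    by (fastforce simp: box_edges_def lattice_edges_def segment_def intro: hull_inc)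
  show "finite (Pow (box_of m \<inter> (lattice_points :: (real ^ 'n) set)))"
    using finite_box_lattice by (simp only: finite_Pow_iff)
qed

definition percolation :: "nat \<Rightarrow> real \<Rightarrow> 'n::finite configuration measure" where
  "percolation m p = measure_pmf (Pi_pmf (box_edges m) False (\<lambda>_. bernoulli_pmf p))"

text \<open>The distance from \<open>e\<close> to \<open>\<Lambda>\<^sup>c \<union> (\<P> \<setminus> {e})\<close>. Both arguments of \<open>setdist\<close> are
  nonempty, so that it is the infimum of the pointwise distances.\<close>

definition isolation :: "'n::finite \<Rightarrow> nat \<Rightarrow> 'n configuration \<Rightarrow> (real ^ 'n) set \<Rightarrow> real" where
  "isolation v m \<omega> e =
     setdist (segment e) (- box_of m \<union> (\<Union>f \<in> pivotal_edges v m \<omega> - {e}. segment f))"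

end

theory Submission
  imports Defs
begin

text \<open>Write \<open>C\<close> and \<open>D\<close> for the open clusters of the top and of the bottom side. If they are
  disjoint, the pivotal edges are exactly the edges of the box with one end in \<open>C\<close> and the other in
  \<open>D\<close> (\<open>pivotal_edges_iff\<close>); in particular they belong to the edge boundary \<open>\<partial>D\<close>, all of whose edges are
  closed.

  The geometric point is that \<open>\<partial>D\<close> cannot surround a pivotal edge \<open>e\<close> locally. Let \<open>K\<close> be the part of
  \<open>\<partial>D\<close> that can be reached from \<open>e\<close> by short steps inside \<open>\<partial>D\<close>. Every unit square contains an even
  number of edges of \<open>K\<close>, so \<open>K\<close> is a cocycle modulo 2. If \<open>K\<close> had no edge in the face \<open>x $ i = m\<close>, for
  a horizontal axis \<open>i\<close>, then \<open>K\<close> would be the coboundary of the set \<open>A\<close> of points from which the ray in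
  direction \<open>i\<close> crosses \<open>K\<close> an odd number of times (\<open>ray_parity_coboundary\<close>). This set contains no
  point of the top and of the bottom side, and open edges do not cross \<open>K\<close>, so \<open>A\<close> avoids \<open>C\<close> and \<open>D\<close>.
  But \<open>e \<in> K\<close> joins \<open>C\<close> to \<open>D\<close>, a contradiction (\<open>boundary_component_reaches_face\<close>).

  Hence, if \<open>e\<close> is at distance at least \<open>R\<close> from the complement of the box and from the other pivotal
  edges, a shortest path in \<open>K\<close> from \<open>e\<close> to that face starts with \<open>n = \<lfloor>R / 4\<rfloor>\<close> distinct steps to edges
  that are too close to \<open>e\<close> to be pivotal: they are closed and touch \<open>D\<close> but not \<open>C\<close>
  (\<open>isolated_pivotal_closed_walk\<close>).

  On the probabilistic side, changing the state of an edge that does not touch \<open>C\<close> changes neither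
  \<open>C\<close> nor the absence of a connection. So for a fixed set \<open>F\<close> of edges, the event that the sides are not
  connected and \<open>F\<close> does not touch \<open>C\<close> is independent of the states in \<open>F\<close>, and requiring in addition
  that \<open>F\<close> is closed costs a factor \<open>(1 - p) ^ card F\<close> (\<open>prob_closed_off_cluster\<close>). There are
  at most \<open>|\<Lambda>| d M\<^sup>n\<close> candidates for the path, where \<open>M\<close> depends only on the dimension, so the conditional
  probability is at most \<open>|\<Lambda>| d (M (1 - p))\<^sup>n\<close>. For \<open>p\<close> close to 1 this is at most
  \<open>|\<Lambda>| d exp (- n)\<close>, and \<open>R = 16 c ln |\<Lambda>|\<close> makes it at most \<open>|\<Lambda>| powr (- c)\<close>.\<close>

section \<open>Unit edges of the lattice\<close>

definition unit_edge :: "real ^ 'n \<Rightarrow> 'n \<Rightarrow> (real ^ 'n) set" where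
  "unit_edge z i = {z, z + axis i 1}"

lemma lattice_points_add [intro]:
  "x \<in> lattice_points \<Longrightarrow> y \<in> lattice_points \<Longrightarrow> x + y \<in> lattice_points"
  by (auto simp: lattice_points_def)

lemma lattice_points_diff [intro]:
  "x \<in> lattice_points \<Longrightarrow> y \<in> lattice_points \<Longrightarrow> x - y \<in> lattice_points"
  by (auto simp: lattice_points_def)

lemma axis_in_lattice_points [simp]: "axis i 1 \<in> lattice_points"
  by (auto simp: lattice_points_def axis_def)

lemma mem_box_of: "x \<in> box_of m \<longleftrightarrow> (\<forall>i. \<bar>x $ i\<bar> \<le> real m)"
  by (auto simp: box_of_def mem_box_cart abs_le_iff minus_le_iff)

text \<open>The squares of the coordinates are natural numbers with sum 1, so exactly one of them is 1.\<close>

lemma lattice_unit_vector: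
  fixes w :: "real ^ 'n"
  assumes w: "w \<in> lattice_points" and norm: "norm w = 1"
  obtains i where "w = axis i 1 \<or> w = - axis i 1"
proof -
  have sum1: "(\<Sum>i\<in>UNIV. (w $ i)\<^sup>2) = 1"
    using norm by (simp add: norm_vec_def L2_set_def)
  obtain i where i: "w $ i \<noteq> 0"
    using sum1 by fastforce
  obtain k :: int where k: "w $ i = of_int k"
    using w by (auto simp: lattice_points_def elim: Ints_cases)
  have "1 \<le> k\<^sup>2"
    using i k by (simp add: int_one_le_iff_zero_less)
  then have ge1: "1 \<le> (w $ i)\<^sup>2"
    unfolding k by (metis of_int_1_le_iff of_int_power)
  have split: "(\<Sum>j\<in>UNIV. (w $ j)\<^sup>2) = (w $ i)\<^sup>2 + (\<Sum>j\<in>UNIV - {i}. (w $ j)\<^sup>2)"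
    by (simp add: sum.remove)
  have "(\<Sum>j\<in>UNIV - {i}. (w $ j)\<^sup>2) \<ge> 0"
    by (simp add: sum_nonneg)
  then have sq: "(w $ i)\<^sup>2 = 1" and rest: "(\<Sum>j\<in>UNIV - {i}. (w $ j)\<^sup>2) = 0"
    using split sum1 ge1 by linarith+
  have "w $ j = 0" if "j \<noteq> i" for j
    using rest that by (subst (asm) sum_nonneg_eq_0_iff) auto
  moreover have "w $ i = 1 \<or> w $ i = -1"
    using sq by (simp add: power2_eq_1_iff)
  ultimately have "w = axis i 1 \<or> w = - axis i 1"
    by (auto simp: vec_eq_iff axis_def)
  then show ?thesis by (rule that)
qed

lemma unit_edge_in_box_edges:
  fixes z :: "real ^ 'n"
  shows "unit_edge z i \<in> box_edges m \<longleftrightarrow> z \<in> lattice_points \<and> z \<in> box_of m \<and> z + axis i 1 \<in> box_of m"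
proof -
  have "convex (box_of m :: (real ^ 'n) set)"
    by (simp add: box_of_def)
  then have conv: "segment (unit_edge z i) \<subseteq> box_of m \<longleftrightarrow> z \<in> box_of m \<and> z + axis i 1 \<in> box_of m"
    unfolding segment_def unit_edge_def by (simp add: subset_hull [where S = convex])
  have dist: "dist z (z + axis i 1) = 1"
    by (simp add: dist_norm)
  have "unit_edge z i \<in> lattice_edges \<longleftrightarrow> z \<in> lattice_points"
  proof
    assume "z \<in> lattice_points"
    then show "unit_edge z i \<in> lattice_edges"
      unfolding lattice_edges_def unit_edge_def using dist lattice_points_add axis_in_lattice_points
      by (intro CollectI exI conjI) (rule refl, assumption, blast+)
  next
    assume "unit_edge z i \<in> lattice_edges"
    then obtain x y where "unit_edge z i = {x, y}" "x \<in> lattice_points" "y \<in> lattice_points"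
      by (auto simp: lattice_edges_def)
    then show "z \<in> lattice_points"
      unfolding unit_edge_def by (metis insertE insertI1 singletonD)
  qed
  then show ?thesis
    using conv by (auto simp: box_edges_def)
qed

lemma box_edgesE:
  assumes "e \<in> box_edges m"
  obtains z i where "e = unit_edge z i" "z \<in> lattice_points" "z \<in> box_of m"
    "z + axis i 1 \<in> box_of m"
proof -
  obtain x y where e: "e = {x, y}" and xy: "x \<in> lattice_points" "y \<in> lattice_points"
    and d: "dist x y = 1"
    using assms by (auto simp: box_edges_def lattice_edges_def)
  have "norm (y - x) = 1"
    using d by (simp add: dist_norm norm_minus_commute)
  then obtain i where "y - x = axis i 1 \<or> y - x = - axis i 1"
    using lattice_unit_vector xy by blast
  then have "y = x + axis i 1 \<or> x = y + axis i 1"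
    by (auto simp: algebra_simps)
  then have "e = unit_edge x i \<or> e = unit_edge y i"
    by (auto simp: e unit_edge_def)
  then show ?thesis
    using assms that unit_edge_in_box_edges [of x i m] unit_edge_in_box_edges [of y i m] by blast
qed

lemma box_edge_subset:
  assumes "e \<in> box_edges m" shows "e \<subseteq> box_of m" "e \<subseteq> lattice_points"
  using assms lattice_points_add [OF _ axis_in_lattice_points]
  by (auto elim!: box_edgesE simp: unit_edge_def)

lemma dist_box_edge:
  assumes "e \<in> box_edges m" "x \<in> e" "y \<in> e" shows "dist x y \<le> 1"
  using assms by (auto elim!: box_edgesE simp: unit_edge_def dist_norm)

section \<open>Open clusters and pivotal edges\<close>

definition open_steps :: "nat \<Rightarrow> 'n::finite configuration \<Rightarrow> ((real ^ 'n) \<times> (real ^ 'n)) set" where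
  "open_steps m \<omega> = {(x, y). {x, y} \<in> box_edges m \<and> \<omega> {x, y}}"

definition open_cluster ::
  "nat \<Rightarrow> (real ^ 'n) set \<Rightarrow> 'n::finite configuration \<Rightarrow> (real ^ 'n) set" where
  "open_cluster m S \<omega> = (open_steps m \<omega>)\<^sup>* `` (S \<inter> lattice_points)"

lemma open_steps_sym: "(x, y) \<in> open_steps m \<omega> \<longleftrightarrow> (y, x) \<in> open_steps m \<omega>"
  by (simp add: open_steps_def insert_commute)

lemma open_steps_rtrancl_sym:
  "(x, y) \<in> (open_steps m \<omega>)\<^sup>* \<longleftrightarrow> (y, x) \<in> (open_steps m \<omega>)\<^sup>*"
  by (metis open_steps_sym symI sym_rtrancl symD)

lemma open_path_iff_rtrancl:
  "(\<exists>xs. open_path m \<omega> xs \<and> hd xs = x \<and> last xs = y) \<longleftrightarrow>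
     x \<in> lattice_points \<and> (x, y) \<in> (open_steps m \<omega>)\<^sup>*"
proof
  assume "\<exists>xs. open_path m \<omega> xs \<and> hd xs = x \<and> last xs = y"
  then obtain xs where "open_path m \<omega> xs" "hd xs = x" "last xs = y" by blast
  then show "x \<in> lattice_points \<and> (x, y) \<in> (open_steps m \<omega>)\<^sup>*"
  proof (induction xs arbitrary: x)
    case Nil
    then show ?case by (simp add: open_path_def)
  next
    case (Cons a xs)
    show ?case
    proof (cases xs)
      case Nil
      then show ?thesis using Cons.prems by (auto simp: open_path_def)
    next
      case (Cons b ys)
      then have "open_path m \<omega> xs" "(a, b) \<in> open_steps m \<omega>" "a = x" "a \<in> lattice_points"
        "hd xs = b" "last xs = y"
        using Cons.prems by (auto simp: open_path_def open_steps_def)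
      then show ?thesis
        using Cons.IH [of b] by (auto intro: converse_rtrancl_into_rtrancl)
    qed
  qed
next
  assume *: "x \<in> lattice_points \<and> (x, y) \<in> (open_steps m \<omega>)\<^sup>*"
  then have "(x, y) \<in> (open_steps m \<omega>)\<^sup>*" by blast
  then show "\<exists>xs. open_path m \<omega> xs \<and> hd xs = x \<and> last xs = y"
  proof (induction rule: rtrancl_induct)
    case base
    show ?case
      using * by (intro exI [of _ "[x]"]) (simp add: open_path_def)
  next
    case (step y z)
    then obtain xs where xs: "open_path m \<omega> xs" "hd xs = x" "last xs = y" by blast
    have "z \<in> lattice_points"
      using step(2) box_edge_subset(2) by (fastforce simp: open_steps_def)
    then have "open_path m \<omega> (xs @ [z])"
      using xs step(2)
      by (auto simp: open_path_def open_steps_def successively_append_iff)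
    then show ?case
      using xs by (intro exI [of _ "xs @ [z]"]) (auto simp: open_path_def)
  qed
qed

lemma open_cluster_step:
  assumes "x \<in> open_cluster m S \<omega>" "(x, y) \<in> open_steps m \<omega>"
  shows "y \<in> open_cluster m S \<omega>"
  using assms by (auto simp: open_cluster_def Image_iff intro: rtrancl_into_rtrancl)

lemma open_cluster_base: "x \<in> S \<Longrightarrow> x \<in> lattice_points \<Longrightarrow> x \<in> open_cluster m S \<omega>"
  by (auto simp: open_cluster_def)

lemma open_cluster_subset_lattice: "open_cluster m S \<omega> \<subseteq> lattice_points"
proof
  fix y assume "y \<in> open_cluster m S \<omega>"
  then obtain x where "x \<in> lattice_points" "(x, y) \<in> (open_steps m \<omega>)\<^sup>*"
    by (auto simp: open_cluster_def)
  from this(2,1) show "y \<in> lattice_points"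
    by (induction rule: rtrancl_induct)
      (use box_edge_subset(2) in \<open>fastforce simp: open_steps_def\<close>)+
qed

lemma open_cluster_Int_open_cluster:
  "open_cluster m S \<omega> \<inter> open_cluster m S' \<omega> = {} \<longleftrightarrow> open_cluster m S \<omega> \<inter> S' = {}"
proof -
  have "z \<notin> open_cluster m S' \<omega>" if "open_cluster m S \<omega> \<inter> S' = {}" "z \<in> open_cluster m S \<omega>" for z
  proof
    assume "z \<in> open_cluster m S' \<omega>"
    then obtain y where y: "y \<in> S'" "(y, z) \<in> (open_steps m \<omega>)\<^sup>*"
      by (auto simp: open_cluster_def)
    from y(2) have "(z, y) \<in> (open_steps m \<omega>)\<^sup>*"
      by (simp only: open_steps_rtrancl_sym)
    then have "y \<in> open_cluster m S \<omega>"
      using that(2) by (auto simp: open_cluster_def intro: rtrancl_trans)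
    then show False using y(1) that(1) by blast
  qed
  moreover have "z \<notin> S'" if "open_cluster m S \<omega> \<inter> open_cluster m S' \<omega> = {}" "z \<in> open_cluster m S \<omega>" for z
    using that open_cluster_base [of z S'] open_cluster_subset_lattice by blast
  ultimately show ?thesis by blast
qed

lemma top_bottom_connected_iff:
  "top_bottom_connected v m \<omega> \<longleftrightarrow> open_cluster m (top_side v m) \<omega> \<inter> bottom_side v m \<noteq> {}"
proof -
  have "top_bottom_connected v m \<omega> \<longleftrightarrow>
    (\<exists>x y. x \<in> top_side v m \<and> y \<in> bottom_side v m \<and> x \<in> lattice_points \<and> (x, y) \<in> (open_steps m \<omega>)\<^sup>*)"
    unfolding top_bottom_connected_def using open_path_iff_rtrancl by metis
  then show ?thesis by (auto simp: open_cluster_def)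
qed

lemma top_bottom_connected_iff_clusters:
  "top_bottom_connected v m \<omega> \<longleftrightarrow>
     open_cluster m (top_side v m) \<omega> \<inter> open_cluster m (bottom_side v m) \<omega> \<noteq> {}"
  by (simp add: top_bottom_connected_iff open_cluster_Int_open_cluster)

text \<open>An edge with no end in the cluster is never used when the cluster is explored. This is the source
  both of the independence below and of the description of pivotal edges.\<close>

lemma open_cluster_fun_upd:
  assumes "e \<inter> open_cluster m S \<omega> = {}"
  shows "open_cluster m S (fun_upd \<omega> e b) = open_cluster m S \<omega>"
proof
  show "open_cluster m S (fun_upd \<omega> e b) \<subseteq> open_cluster m S \<omega>"
  proof
    fix y assume "y \<in> open_cluster m S (fun_upd \<omega> e b)"
    then obtain x where x: "x \<in> S" "x \<in> lattice_points"
      and r: "(x, y) \<in> (open_steps m (fun_upd \<omega> e b))\<^sup>*"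
      by (auto simp: open_cluster_def)
    from r show "y \<in> open_cluster m S \<omega>"
    proof (induction rule: rtrancl_induct)
      case base
      show ?case using x by (simp add: open_cluster_base)
    next
      case (step y z)
      then have "{y, z} \<noteq> e" using assms by blast
      then have "(y, z) \<in> open_steps m \<omega>"
        using step(2) by (auto simp: open_steps_def)
      then show ?case using step(3) open_cluster_step by blast
    qed
  qed
next
  show "open_cluster m S \<omega> \<subseteq> open_cluster m S (fun_upd \<omega> e b)"
  proof
    fix y assume "y \<in> open_cluster m S \<omega>"
    then obtain x where x: "x \<in> S" "x \<in> lattice_points"
      and r: "(x, y) \<in> (open_steps m \<omega>)\<^sup>*"
      by (auto simp: open_cluster_def)
    from r show "y \<in> open_cluster m S (fun_upd \<omega> e b)"
    proof (induction rule: rtrancl_induct)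
      case base
      show ?case using x by (simp add: open_cluster_base)
    next
      case (step y z)
      have "y \<in> open_cluster m S \<omega>"
        using x step(1) by (auto simp: open_cluster_def)
      then have "{y, z} \<noteq> e" using assms by blast
      then have "(y, z) \<in> open_steps m (fun_upd \<omega> e b)"
        using step(2) by (auto simp: open_steps_def)
      then show ?case using step(3) open_cluster_step by blast
    qed
  qed
qed

text \<open>If \<open>e\<close> misses one of the two clusters, opening it leaves that cluster unchanged, hence still
  disjoint from the opposite side. Otherwise \<open>e\<close> bridges two disjoint clusters.\<close>

lemma pivotal_edges_iff:
  assumes nc: "\<not> top_bottom_connected v m \<omega>"
  shows "e \<in> pivotal_edges v m \<omega> \<longleftrightarrow> e \<in> box_edges m \<and>
    e \<inter> open_cluster m (top_side v m) \<omega> \<noteq> {} \<and> e \<inter> open_cluster m (bottom_side v m) \<omega> \<noteq> {}"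
proof -
  let ?C = "\<lambda>\<omega>. open_cluster m (top_side v m) \<omega>" and ?D = "\<lambda>\<omega>. open_cluster m (bottom_side v m) \<omega>"
  have disj: "?C \<omega> \<inter> ?D \<omega> = {}"
    using nc top_bottom_connected_iff_clusters by blast
  let ?w = "fun_upd \<omega> e True"
  have mono: "open_cluster m S \<omega> \<subseteq> open_cluster m S ?w" for S
  proof -
    have "open_steps m \<omega> \<subseteq> open_steps m ?w" by (auto simp: open_steps_def)
    then show ?thesis unfolding open_cluster_def by (meson Image_mono order_refl rtrancl_mono)
  qed
  have "top_bottom_connected v m ?w \<longleftrightarrow> e \<inter> ?C \<omega> \<noteq> {} \<and> e \<inter> ?D \<omega> \<noteq> {}" if e: "e \<in> box_edges m"
  proof
    assume tb: "top_bottom_connected v m ?w"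
    show "e \<inter> ?C \<omega> \<noteq> {} \<and> e \<inter> ?D \<omega> \<noteq> {}"
    proof (rule ccontr)
      assume "\<not> ?thesis"
      then have "?C ?w = ?C \<omega> \<or> ?D ?w = ?D \<omega>"
        using open_cluster_fun_upd by meson
      then show False
        using tb nc open_cluster_Int_open_cluster
        unfolding top_bottom_connected_iff_clusters by (metis inf_commute)
    qed
  next
    assume "e \<inter> ?C \<omega> \<noteq> {} \<and> e \<inter> ?D \<omega> \<noteq> {}"
    then obtain x y where xy: "x \<in> e" "y \<in> e" "x \<in> ?C \<omega>" "y \<in> ?D \<omega>" by blast
    then have "x \<noteq> y" using disj by blast
    then have "e = {x, y}"
      using e xy(1,2) by (auto elim!: box_edgesE simp: unit_edge_def)
    then have "(x, y) \<in> open_steps m ?w" using e by (simp add: open_steps_def)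
    then have "y \<in> ?C ?w \<inter> ?D ?w"
      using xy mono open_cluster_step by blast
    then show "top_bottom_connected v m ?w"
      using top_bottom_connected_iff_clusters by blast
  qed
  then show ?thesis by (auto simp: pivotal_edges_def)
qed


section \<open>Closed edges away from the top cluster\<close>

text \<open>Unlike \<open>measure_pmf_prob_product\<close>, this covers uncountable sets, such as sets of configurations
  of all edges of the lattice.\<close>

lemma prob_pair_pmf_Times:
  "measure_pmf.prob (pair_pmf M N) (A \<times> B) = measure_pmf.prob M A * measure_pmf.prob N B"
proof -
  have "measure_pmf.prob (pair_pmf M N) (A \<times> B) =
      measure_pmf.prob (pair_pmf M N) ((A \<inter> set_pmf M) \<times> (B \<inter> set_pmf N))"
    by (subst measure_Int_set_pmf [symmetric]) (simp add: Times_Int_Times)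
  then show ?thesis
    by (simp add: measure_pmf_prob_product measure_Int_set_pmf)
qed

text \<open>An event that does not depend on the state of \<open>x\<close> is independent of that state.\<close>

lemma prob_invariant_Int_False:
  fixes X :: "('a \<Rightarrow> bool) set"
  assumes A: "finite A" "x \<in> A" and p: "0 \<le> p" "p \<le> 1"
    and inv: "\<And>\<omega> b. fun_upd \<omega> x b \<in> X \<longleftrightarrow> \<omega> \<in> X"
  defines "P \<equiv> Pi_pmf A False (\<lambda>_. bernoulli_pmf p)"
  shows "measure_pmf.prob P (X \<inter> {\<omega>. \<not> \<omega> x}) = (1 - p) * measure_pmf.prob P X"
proof -
  let ?Q = "Pi_pmf (A - {x}) False (\<lambda>_. bernoulli_pmf p)"
  let ?u = "\<lambda>(y, f). fun_upd f x y"
  have "A = insert x (A - {x})" using A by blast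
  then have P: "P = map_pmf ?u (pair_pmf (bernoulli_pmf p) ?Q)"
    unfolding P_def using A(1) Pi_pmf_insert [of "A - {x}" x False "\<lambda>_. bernoulli_pmf p"] by simp
  have "?u -` X = UNIV \<times> X" "?u -` (X \<inter> {\<omega>. \<not> \<omega> x}) = {False} \<times> X"
    using inv by auto
  then have "measure_pmf.prob P X = measure_pmf.prob ?Q X"
    "measure_pmf.prob P (X \<inter> {\<omega>. \<not> \<omega> x}) = (1 - p) * measure_pmf.prob ?Q X"
    unfolding P measure_map_pmf using p
    by (simp_all add: prob_pair_pmf_Times measure_pmf_single)
  then show ?thesis by simp
qed

lemma prob_invariant_Int_all_False:
  fixes X :: "('a \<Rightarrow> bool) set"
  assumes A: "finite A" "F \<subseteq> A" and p: "0 \<le> p" "p \<le> 1"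
    and inv: "\<And>\<omega> x b. x \<in> F \<Longrightarrow> fun_upd \<omega> x b \<in> X \<longleftrightarrow> \<omega> \<in> X"
  defines "P \<equiv> Pi_pmf A False (\<lambda>_. bernoulli_pmf p)"
  shows "measure_pmf.prob P (X \<inter> {\<omega>. \<forall>x\<in>F. \<not> \<omega> x}) = (1 - p) ^ card F * measure_pmf.prob P X"
proof -
  have "finite F" using A finite_subset by blast
  then show ?thesis using A(2) inv
  proof (induction F rule: finite_induct)
    case empty
    then show ?case by simp
  next
    case (insert x F)
    let ?Y = "X \<inter> {\<omega>. \<forall>x\<in>F. \<not> \<omega> x}"
    have inv': "fun_upd \<omega> x b \<in> ?Y \<longleftrightarrow> \<omega> \<in> ?Y" for \<omega> b
    proof -
      have "fun_upd \<omega> x b \<in> X \<longleftrightarrow> \<omega> \<in> X"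
        using insert.prems(2) by blast
      moreover have "\<forall>y\<in>F. fun_upd \<omega> x b y = \<omega> y"
        using insert.hyps(2) by auto
      ultimately show ?thesis by (simp del: fun_upd_apply)
    qed
    have "X \<inter> {\<omega>. \<forall>x\<in>insert x F. \<not> \<omega> x} = ?Y \<inter> {\<omega>. \<not> \<omega> x}" by auto
    then have "measure_pmf.prob P (X \<inter> {\<omega>. \<forall>x\<in>insert x F. \<not> \<omega> x}) =
        (1 - p) * measure_pmf.prob P ?Y"
      unfolding P_def
      using prob_invariant_Int_False [OF A(1) _ p inv'] insert.prems(1) by simp
    also have "measure_pmf.prob P ?Y = (1 - p) ^ card F * measure_pmf.prob P X"
      using insert.IH insert.prems by simp
    finally show ?case using insert.hyps by simp
  qed
qed

text \<open>The event \<open>X\<close> that the sides are not connected and no edge of \<open>F\<close> touches the top cluster is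
  invariant under changes of the configuration on \<open>F\<close>, although the top cluster itself is random.\<close>

lemma prob_closed_off_cluster:
  fixes v :: "'n::finite" and p :: real
  assumes F: "F \<subseteq> box_edges m" and p: "0 \<le> p" "p \<le> 1"
  shows "measure (percolation m p) {\<omega>. \<not> top_bottom_connected v m \<omega> \<and>
      (\<forall>f\<in>F. \<not> \<omega> f \<and> f \<inter> open_cluster m (top_side v m) \<omega> = {})}
    \<le> (1 - p) ^ card F * measure (percolation m p) {\<omega>. \<not> top_bottom_connected v m \<omega>}"
proof -
  let ?C = "\<lambda>\<omega>. open_cluster m (top_side v m) \<omega>"
  define X where "X = {\<omega>. \<not> top_bottom_connected v m \<omega> \<and> (\<forall>f\<in>F. f \<inter> ?C \<omega> = {})}"
  have X_upd: "fun_upd \<omega> x b \<in> X" if "x \<in> F" "\<omega> \<in> X" for \<omega> x b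
  proof -
    have "?C (fun_upd \<omega> x b) = ?C \<omega>"
      using that by (intro open_cluster_fun_upd) (auto simp: X_def)
    then show ?thesis
      using that by (simp add: X_def top_bottom_connected_iff)
  qed
  have inv: "fun_upd \<omega> x b \<in> X \<longleftrightarrow> \<omega> \<in> X" if "x \<in> F" for \<omega> x b
    \<comment> \<open>The converse direction restores the original state of \<open>x\<close>.\<close>
    using X_upd [OF that, of \<omega> b] X_upd [OF that, of "fun_upd \<omega> x b" "\<omega> x"] by auto
  have "{\<omega>. \<not> top_bottom_connected v m \<omega> \<and> (\<forall>f\<in>F. \<not> \<omega> f \<and> f \<inter> ?C \<omega> = {})}
      = X \<inter> {\<omega>. \<forall>f\<in>F. \<not> \<omega> f}"
    by (auto simp: X_def)
  moreover have "measure (percolation m p) (X \<inter> {\<omega>. \<forall>f\<in>F. \<not> \<omega> f}) =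
      (1 - p) ^ card F * measure (percolation m p) X"
    unfolding percolation_def
    using prob_invariant_Int_all_False [OF finite_box_edges F p inv] by simp
  moreover have "measure (percolation m p) X \<le>
      measure (percolation m p) {\<omega>. \<not> top_bottom_connected v m \<omega>}"
    unfolding percolation_def
    by (rule measure_pmf.finite_measure_mono) (auto simp: X_def)
  ultimately show ?thesis
    using p by (simp add: mult_left_mono)
qed

section \<open>Counting walks of nearby edges\<close>

text \<open>The starting point is not an entry of the walk: in the application it is the pivotal edge, which,
  unlike the subsequent edges, does touch the top cluster.\<close>

fun walks :: "('a \<Rightarrow> 'a set) \<Rightarrow> nat \<Rightarrow> 'a \<Rightarrow> 'a list set" where
  "walks N 0 x = {[]}"
| "walks N (Suc n) x = (\<Union>y\<in>N x. (#) y ` walks N n y)"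

lemma walks_length_set:
  assumes "\<And>x. N x \<subseteq> S"
  shows "l \<in> walks N n x \<Longrightarrow> length l = n \<and> set l \<subseteq> S"
  using assms by (induction n arbitrary: x l) (simp, fastforce)

lemma finite_card_walks:
  assumes N: "\<And>x. N x \<subseteq> S" "\<And>x. x \<in> S \<Longrightarrow> finite (N x)" "\<And>x. x \<in> S \<Longrightarrow> card (N x) \<le> M"
    and x: "x \<in> S"
  shows "finite (walks N n x) \<and> card (walks N n x) \<le> M ^ n"
  using x
proof (induction n arbitrary: x)
  case 0
  then show ?case by simp
next
  case (Suc n)
  have IH: "finite (walks N n y)" "card (walks N n y) \<le> M ^ n" if "y \<in> N x" for y
    using Suc.IH [of y] that N(1) by blast+
  have "card (walks N (Suc n) x) \<le> (\<Sum>y\<in>N x. card ((#) y ` walks N n y))"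
    using card_UN_le [OF N(2) [OF Suc.prems]] by simp
  also have "\<dots> \<le> (\<Sum>y\<in>N x. M ^ n)"
    using IH by (intro sum_mono) (meson card_image_le le_trans)
  also have "\<dots> \<le> M * M ^ n"
    using N(3) [OF Suc.prems] by simp
  finally show ?case
    using N(2) [OF Suc.prems] IH(1) by simp
qed

lemma walks_of_sequence:
  assumes "\<And>i. i < n \<Longrightarrow> f (Suc i) \<in> N (f i)"
  shows "map (\<lambda>i. f (Suc i)) [0..<n] \<in> walks N n (f 0)"
  using assms
proof (induction n arbitrary: f)
  case 0
  then show ?case by simp
next
  case (Suc n)
  have "map (\<lambda>i. f (Suc (Suc i))) [0..<n] \<in> walks N n (f (Suc 0))"
    using Suc.IH [of "\<lambda>i. f (Suc i)"] Suc.prems by simp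
  moreover have "map (\<lambda>i. f (Suc i)) [0..<Suc n] = f (Suc 0) # map (\<lambda>i. f (Suc (Suc i))) [0..<n]"
    by (subst map_upt_Suc) simp
  ultimately show ?case using Suc.prems [of 0] by auto
qed

text \<open>Two edges of a common unit square are near each other. All that matters about the constant 2 is
  that it allows this, bounds the speed of a walk, and keeps the number of neighbours finite
  uniformly in \<open>m\<close>.\<close>

definition near_edges :: "nat \<Rightarrow> (real ^ 'n) set \<Rightarrow> (real ^ 'n) set set" where
  "near_edges m e = {g \<in> box_edges m. \<forall>x\<in>e. \<forall>y\<in>g. dist x y \<le> 2}"

definition near_edges_bound :: "'n::finite itself \<Rightarrow> nat" where
  "near_edges_bound _ = box_card TYPE('n) 2 * CARD('n)"

text \<open>By translation, a near edge is described by its axis and by the offset of its lower end from a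
  fixed end of \<open>e\<close>, which is a lattice point with coordinates in \<open>[-2, 2]\<close>.\<close>

lemma card_near_edges:
  fixes e :: "(real ^ 'n) set"
  assumes e: "e \<in> box_edges m"
  shows "card (near_edges m e) \<le> near_edges_bound TYPE('n)"
proof -
  obtain x where x: "x \<in> e" "x \<in> lattice_points"
    using e by (rule box_edgesE) (auto simp: unit_edge_def)
  let ?S = "(box_of 2 \<inter> lattice_points :: (real ^ 'n) set) \<times> (UNIV :: 'n set)"
  have fin: "finite ?S"
    using finite_box_lattice by (intro finite_cartesian_product) auto
  have "near_edges m e \<subseteq> (\<lambda>(w, i). unit_edge (x + w) i) ` ?S"
  proof
    fix g assume g: "g \<in> near_edges m e"
    then obtain z i where z: "g = unit_edge z i" "z \<in> lattice_points"
      by (auto simp: near_edges_def elim: box_edgesE)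
    have "dist x z \<le> 2"
      using g x(1) z(1) by (auto simp: near_edges_def unit_edge_def)
    then have "\<bar>(z - x) $ j\<bar> \<le> 2" for j
      using component_le_norm_cart [of "z - x" j] by (simp add: dist_norm norm_minus_commute)
    then have "(z - x, i) \<in> ?S"
      using x(2) z(2) by (auto simp: mem_box_of intro: lattice_points_diff)
    then show "g \<in> (\<lambda>(w, i). unit_edge (x + w) i) ` ?S"
      using z(1) by force
  qed
  then have "card (near_edges m e) \<le> card ?S"
    using fin by (meson card_image_le card_mono finite_imageI le_trans)
  then show ?thesis
    by (simp add: near_edges_bound_def box_card_def card_cartesian_product)
qed

lemma card_box_edges:
  "card (box_edges m :: (real ^ 'n) set set) \<le> box_card TYPE('n) m * CARD('n)"
proof -
  let ?S = "(box_of m \<inter> lattice_points :: (real ^ 'n) set) \<times> (UNIV :: 'n set)"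
  have fin: "finite ?S"
    using finite_box_lattice by (intro finite_cartesian_product) auto
  have "(box_edges m :: (real ^ 'n) set set) \<subseteq> (\<lambda>(z, i). unit_edge z i) ` ?S"
    by (force elim: box_edgesE)
  then have "card (box_edges m :: (real ^ 'n) set set) \<le> card ?S"
    using fin by (meson card_image_le card_mono finite_imageI le_trans)
  then show ?thesis
    by (simp add: box_card_def card_cartesian_product)
qed

definition closed_walk_off_cluster :: "'n::finite \<Rightarrow> nat \<Rightarrow> 'n configuration \<Rightarrow> (real ^ 'n) set list \<Rightarrow> bool" where
  "closed_walk_off_cluster v m \<omega> l \<longleftrightarrow> distinct l \<and>
     (\<forall>f\<in>set l. \<not> \<omega> f \<and> f \<inter> open_cluster m (top_side v m) \<omega> = {})"

text \<open>Union bound over the starting edge and the walk.\<close>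

lemma prob_ex_closed_walk:
  fixes v :: "'n::finite" and p :: real
  assumes p: "0 \<le> p" "p \<le> 1"
  shows "measure (percolation m p) {\<omega>. \<not> top_bottom_connected v m \<omega> \<and>
      (\<exists>e\<in>box_edges m. \<exists>l\<in>walks (near_edges m) n e. closed_walk_off_cluster v m \<omega> l)}
    \<le> real (box_card TYPE('n) m * CARD('n)) * (real (near_edges_bound TYPE('n)) * (1 - p)) ^ n
      * measure (percolation m p) {\<omega>. \<not> top_bottom_connected v m \<omega>}"
proof -
  let ?P = "Pi_pmf (box_edges m) False (\<lambda>_. bernoulli_pmf p) :: 'n configuration pmf"
  let ?q = "measure_pmf.prob ?P {\<omega>. \<not> top_bottom_connected v m \<omega>}"
  let ?W = "\<lambda>e :: (real ^ 'n) set. {l \<in> walks (near_edges m) n e. distinct l}"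
  let ?M = "near_edges_bound TYPE('n)"
  let ?ev = "\<lambda>l. {\<omega>. \<not> top_bottom_connected v m \<omega> \<and>
      (\<forall>f\<in>set l. \<not> \<omega> f \<and> f \<inter> open_cluster m (top_side v m) \<omega> = {})}"
  let ?E = "box_edges m :: (real ^ 'n) set set"
  have sub: "near_edges m x \<subseteq> ?E" for x by (auto simp: near_edges_def)
  have fin: "finite (near_edges m x)" for x :: "(real ^ 'n) set"
    using sub finite_box_edges finite_subset by blast
  have walks: "finite (walks (near_edges m) n e)" "card (walks (near_edges m) n e) \<le> ?M ^ n"
    if "e \<in> ?E" for e
    using finite_card_walks [of "near_edges m" ?E ?M e n] sub fin card_near_edges that by blast+
  have finW: "finite (?W e)" and cardW: "card (?W e) \<le> ?M ^ n" if "e \<in> ?E" for e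
    using walks [OF that] by (auto intro: le_trans [OF card_mono])
  have evb: "measure_pmf.prob ?P (?ev l) \<le> (1 - p) ^ n * ?q" if l: "l \<in> ?W e" for e l
  proof -
    have "length l = n" "set l \<subseteq> ?E" "distinct l"
      using walks_length_set [of "near_edges m" ?E l n e] sub l by auto
    then show ?thesis
      using prob_closed_off_cluster [of "set l" m p v] p
      by (simp add: percolation_def distinct_card)
  qed
  have "{\<omega>. \<not> top_bottom_connected v m \<omega> \<and>
      (\<exists>e\<in>?E. \<exists>l\<in>walks (near_edges m) n e. closed_walk_off_cluster v m \<omega> l)}
      = (\<Union>e\<in>?E. \<Union>l\<in>?W e. ?ev l)"
    by (auto simp: closed_walk_off_cluster_def)
  then have "measure_pmf.prob ?P {\<omega>. \<not> top_bottom_connected v m \<omega> \<and>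
      (\<exists>e\<in>?E. \<exists>l\<in>walks (near_edges m) n e. closed_walk_off_cluster v m \<omega> l)}
      \<le> (\<Sum>e\<in>?E. measure_pmf.prob ?P (\<Union>l\<in>?W e. ?ev l))"
    by (simp only:) (intro measure_pmf.finite_measure_subadditive_finite, auto intro: finite_box_edges)
  also have "\<dots> \<le> (\<Sum>e\<in>?E. \<Sum>l\<in>?W e. measure_pmf.prob ?P (?ev l))"
    using finW by (intro sum_mono measure_pmf.finite_measure_subadditive_finite) auto
  also have "\<dots> \<le> (\<Sum>e\<in>?E. \<Sum>l\<in>?W e. (1 - p) ^ n * ?q)"
    using evb by (intro sum_mono) blast
  also have "\<dots> \<le> (\<Sum>e\<in>?E. real (?M ^ n) * ((1 - p) ^ n * ?q))"
  proof (intro sum_mono)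
    fix e assume "e \<in> ?E"
    then have "real (card (?W e)) \<le> real (?M ^ n)" using cardW of_nat_mono by blast
    then show "(\<Sum>l\<in>?W e. (1 - p) ^ n * ?q) \<le> real (?M ^ n) * ((1 - p) ^ n * ?q)"
      using p by (simp only: sum_constant) (intro mult_right_mono, auto)
  qed
  also have "\<dots> = real (card ?E) * ((real ?M * (1 - p)) ^ n * ?q)"
    by (simp add: power_mult_distrib)
  also have "\<dots> \<le> real (box_card TYPE('n) m * CARD('n)) * ((real ?M * (1 - p)) ^ n * ?q)"
    using card_box_edges [of m, where 'n = 'n] p by (intro mult_right_mono of_nat_mono) auto
  finally show ?thesis by (simp add: percolation_def mult.assoc)
qed


section \<open>A primitive of a cocycle modulo 2\<close>

definition ray_parity :: "(real ^ 'n) set set \<Rightarrow> 'n \<Rightarrow> real ^ 'n \<Rightarrow> bool" where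
  "ray_parity K i z \<longleftrightarrow> odd (card {k :: nat. unit_edge (z + real k *\<^sub>R axis i 1) i \<in> K})"

lemma unit_edge_eq_iff: "unit_edge x i = unit_edge y i \<longleftrightarrow> x = y"
proof
  assume "unit_edge x i = unit_edge y i"
  then consider "x = y" | "x = y + axis i 1" "x + axis i 1 = y"
    by (auto simp: unit_edge_def doubleton_eq_iff)
  then show "x = y"
  proof cases
    case 2
    then have "(x + axis i 1) $ i + 1 = x $ i"
      by (simp only: vector_add_component axis_nth)
    then show ?thesis by simp
  qed
qed simp

lemma ray_parity_step:
  assumes K: "finite K"
  shows "(ray_parity K i z \<noteq> ray_parity K i (z + axis i 1)) \<longleftrightarrow> unit_edge z i \<in> K"
proof -
  define S where "S w = {k :: nat. unit_edge (w + real k *\<^sub>R axis i 1) i \<in> K}" for w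
  have fin: "finite (S w)" for w
  proof -
    have "inj (\<lambda>k :: nat. unit_edge (w + real k *\<^sub>R axis i 1) i)"
      by (rule injI) (simp add: unit_edge_eq_iff)
    then show ?thesis
      using finite_vimageI [OF K] by (simp add: S_def vimage_def)
  qed
  have shift: "k \<in> S z \<longleftrightarrow> (k = 0 \<and> unit_edge z i \<in> K) \<or> k \<in> Suc ` S (z + axis i 1)" for k
    by (cases k) (auto simp: S_def algebra_simps)
  have "card (S z) = (if unit_edge z i \<in> K then 1 else 0) + card (S (z + axis i 1))"
  proof (cases "unit_edge z i \<in> K")
    case True
    then have "S z = insert 0 (Suc ` S (z + axis i 1))" using shift by blast
    then show ?thesis using True fin by (simp add: card_image)
  next
    case False
    then have "S z = Suc ` S (z + axis i 1)" using shift by blast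
    then show ?thesis using False by (simp add: card_image)
  qed
  then show ?thesis by (auto simp: ray_parity_def S_def)
qed

text \<open>Discrete Poincare lemma for the box. An edge in direction \<open>i\<close> is exactly what the rays of its two
  ends do not share. For another direction \<open>j\<close>, induction on the distance of \<open>z\<close> from the face
  \<open>x $ i = m\<close>: on the face all rays are empty and \<open>K\<close> has no edge, and the square spanned by \<open>i\<close> and
  \<open>j\<close> at \<open>z\<close> carries the claim from \<open>z + axis i 1\<close> back to \<open>z\<close>.\<close>

lemma ray_parity_coboundary:
  fixes K :: "(real ^ 'n) set set"
  assumes K: "K \<subseteq> box_edges m"
    and face: "\<And>g. g \<in> K \<Longrightarrow> \<exists>x\<in>g. x $ i \<noteq> real m"
    and square: "\<And>z j. \<lbrakk>j \<noteq> i; unit_edge z i \<in> box_edges m; unit_edge z j \<in> box_edges m;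
        unit_edge (z + axis j 1) i \<in> box_edges m; unit_edge (z + axis i 1) j \<in> box_edges m\<rbrakk> \<Longrightarrow>
        ((unit_edge z i \<in> K) \<noteq> (unit_edge (z + axis j 1) i \<in> K)) \<longleftrightarrow>
        ((unit_edge z j \<in> K) \<noteq> (unit_edge (z + axis i 1) j \<in> K))"
    and edge: "unit_edge z j \<in> box_edges m"
  shows "(ray_parity K i z \<noteq> ray_parity K i (z + axis j 1)) \<longleftrightarrow> unit_edge z j \<in> K"
proof (cases "j = i")
  case True
  then show ?thesis
    using ray_parity_step finite_subset [OF K finite_box_edges] by blast
next
  case False
  have fin: "finite K" using finite_subset [OF K finite_box_edges] .
  have z: "z \<in> lattice_points" "z \<in> box_of m"
    using edge by (auto simp: unit_edge_in_box_edges)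
  have "real m - z $ i \<in> \<int>" "0 \<le> real m - z $ i"
    using z by (auto simp: lattice_points_def mem_box_of abs_le_iff)
  then obtain s :: nat where "real m - z $ i = real s"
    by (metis Ints_cases int_nat_eq of_int_0_le_iff of_int_of_nat_eq)
  then show ?thesis using edge
  proof (induction s arbitrary: z)
    case 0
    have "\<not> ray_parity K i w" if "w $ i = real m" for w
    proof -
      have "unit_edge (w + real k *\<^sub>R axis i 1) i \<notin> box_edges m" for k
      proof
        assume "unit_edge (w + real k *\<^sub>R axis i 1) i \<in> box_edges m"
        then have "\<bar>(w + real k *\<^sub>R axis i 1 + axis i 1) $ i\<bar> \<le> real m"
          unfolding unit_edge_in_box_edges mem_box_of by blast
        then show False using that by (simp add: axis_def)
      qed
      then have "{k :: nat. unit_edge (w + real k *\<^sub>R axis i 1) i \<in> K} = {}"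
        using K by blast
      then show ?thesis unfolding ray_parity_def by simp
    qed
    moreover have "unit_edge z j \<notin> K"
      using face [of "unit_edge z j"] 0 False by (auto simp: unit_edge_def axis_def)
    ultimately show ?case using 0 False by (simp add: axis_def)
  next
    case (Suc s)
    have b: "\<bar>z $ l\<bar> \<le> real m" "\<bar>(z + axis j 1) $ l\<bar> \<le> real m" for l
      using Suc.prems(2) by (auto simp: unit_edge_in_box_edges mem_box_of)
    have in_box: "w + axis i 1 \<in> box_of m" if "w = z \<or> w = z + axis j 1" for w
    proof -
      have "\<bar>(w + axis i 1) $ l\<bar> \<le> real m" for l
        using that b [of l] b [of i] Suc.prems(1) False by (cases "l = i") (auto simp: axis_def)
      then show ?thesis by (simp add: mem_box_of)
    qed
    have z: "z \<in> lattice_points" "z \<in> box_of m" "z + axis j 1 \<in> box_of m"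
      using Suc.prems(2) by (auto simp: unit_edge_in_box_edges)
    have comm: "z + axis i 1 + axis j 1 = z + axis j 1 + axis i 1" by simp
    have "z + axis i 1 + axis j 1 \<in> box_of m"
      unfolding comm using in_box by blast
    then have edges: "unit_edge z i \<in> box_edges m" "unit_edge (z + axis j 1) i \<in> box_edges m"
      "unit_edge (z + axis i 1) j \<in> box_edges m"
      using z in_box [of z] in_box [of "z + axis j 1"] lattice_points_add [OF z(1) axis_in_lattice_points]
      by (auto simp: unit_edge_in_box_edges)
    have "real m - (z + axis i 1) $ i = real s"
      using Suc.prems(1) by (simp add: axis_def)
    then have "(ray_parity K i (z + axis i 1) \<noteq> ray_parity K i (z + axis i 1 + axis j 1)) \<longleftrightarrow>
        unit_edge (z + axis i 1) j \<in> K"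
      using Suc.IH edges(3) by blast
    then show ?case
      using square [OF False edges(1) Suc.prems(2) edges(2,3)]
        ray_parity_step [OF fin, of i z] ray_parity_step [OF fin, of i "z + axis j 1"]
      unfolding comm by blast
  qed
qed

section \<open>The component of a pivotal edge in the boundary of the bottom cluster\<close>

text \<open>A path of minimal length visits no point twice, since a loop could be cut out.\<close>

lemma rtrancl_injective_path:
  assumes "(a, b) \<in> r\<^sup>*"
  obtains N f where "f 0 = a" "f N = b" "\<And>i. i < N \<Longrightarrow> (f i, f (Suc i)) \<in> r" "inj_on f {..N}"
proof -
  define N where "N = (LEAST n. (a, b) \<in> r ^^ n)"
  have "\<exists>n. (a, b) \<in> r ^^ n" using assms by (simp add: rtrancl_power)
  then have "(a, b) \<in> r ^^ N" unfolding N_def by (rule LeastI_ex)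
  then obtain f where f: "f 0 = a" "f N = b" "\<And>i. i < N \<Longrightarrow> (f i, f (Suc i)) \<in> r"
    by (auto simp: relpow_fun_conv)
  have "f i \<noteq> f j" if "i < j" "j \<le> N" for i j
  proof
    assume eq: "f i = f j"
    have "(a, f i) \<in> r ^^ i"
      using f that unfolding relpow_fun_conv by (intro exI [of _ f]) auto
    moreover have "(f j, b) \<in> r ^^ (N - j)"
      using f that unfolding relpow_fun_conv by (intro exI [of _ "\<lambda>k. f (j + k)"]) auto
    ultimately have "(a, b) \<in> r ^^ (i + (N - j))"
      using eq by (auto simp: relpow_add)
    then have "N \<le> i + (N - j)"
      unfolding N_def by (rule Least_le)
    then show False using that by simp
  qed
  then have "inj_on f {..N}"
    by (intro linorder_inj_onI) auto
  then show ?thesis using that f by blast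
qed

definition edge_boundary :: "nat \<Rightarrow> (real ^ 'n) set \<Rightarrow> (real ^ 'n) set set" where
  "edge_boundary m D = {f \<in> box_edges m. f \<inter> D \<noteq> {} \<and> \<not> f \<subseteq> D}"

definition boundary_steps :: "nat \<Rightarrow> (real ^ 'n) set \<Rightarrow> ((real ^ 'n) set \<times> (real ^ 'n) set) set" where
  "boundary_steps m D =
     {(f, g). f \<in> edge_boundary m D \<and> g \<in> edge_boundary m D \<and> g \<in> near_edges m f}"

definition boundary_component ::
  "nat \<Rightarrow> (real ^ 'n) set \<Rightarrow> (real ^ 'n) set \<Rightarrow> (real ^ 'n) set set" where
  "boundary_component m D e = (boundary_steps m D)\<^sup>* `` {e}"

lemma boundary_component_subset:
  assumes "e \<in> edge_boundary m D"
  shows "boundary_component m D e \<subseteq> edge_boundary m D"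
proof -
  have "g \<in> edge_boundary m D" if "(e, g) \<in> (boundary_steps m D)\<^sup>*" for g
    using that assms by (induction rule: rtrancl_induct) (auto simp: boundary_steps_def)
  then show ?thesis by (auto simp: boundary_component_def)
qed

text \<open>A closed path of four steps changes its membership in \<open>D\<close> an even number of times. The four edges
  of a square are near each other, so the component contains either all or none of those among them
  that lie in the boundary.\<close>

lemma boundary_component_square:
  fixes z :: "real ^ 'n"
  assumes e: "e \<in> edge_boundary m D"
    and box: "unit_edge z i \<in> box_edges m" "unit_edge z j \<in> box_edges m"
      "unit_edge (z + axis j 1) i \<in> box_edges m" "unit_edge (z + axis i 1) j \<in> box_edges m"
  defines "K \<equiv> boundary_component m D e"
  shows "((unit_edge z i \<in> K) \<noteq> (unit_edge (z + axis j 1) i \<in> K)) \<longleftrightarrow>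
        ((unit_edge z j \<in> K) \<noteq> (unit_edge (z + axis i 1) j \<in> K))"
proof -
  let ?Q = "{unit_edge z i, unit_edge z j, unit_edge (z + axis j 1) i, unit_edge (z + axis i 1) j}"
  let ?V = "{z, z + axis i 1, z + axis j 1, z + axis i 1 + axis j 1}"
  have V: "f \<subseteq> ?V" if "f \<in> ?Q" for f
    using that by (auto simp: unit_edge_def algebra_simps)
  have "norm (axis i 1 + axis j 1 :: real ^ 'n) \<le> 2" "norm (axis i 1 - axis j 1 :: real ^ 'n) \<le> 2"
    using norm_triangle_ineq [of "axis i 1 :: real ^ 'n" "axis j 1"]
      norm_triangle_ineq4 [of "axis i 1 :: real ^ 'n" "axis j 1"] by simp_all
  then have "dist x y \<le> 2" if "x \<in> ?V" "y \<in> ?V" for x y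
    using that
    by (auto simp: dist_norm algebra_simps norm_minus_commute)
  then have near: "g \<in> near_edges m f" if "f \<in> ?Q" "g \<in> ?Q" for f g
    using V [OF that(1)] V [OF that(2)] that(2) box unfolding near_edges_def by blast
  have all: "g \<in> K" if "f \<in> ?Q" "f \<in> K" "g \<in> ?Q" "g \<in> edge_boundary m D" for f g
  proof -
    have "(f, g) \<in> boundary_steps m D"
      using that near boundary_component_subset [OF e] by (auto simp: boundary_steps_def K_def)
    then show ?thesis
      using that(2) by (auto simp: K_def boundary_component_def intro: rtrancl_into_rtrancl)
  qed
  have bd: "unit_edge w l \<in> edge_boundary m D \<longleftrightarrow> ((w \<in> D) \<noteq> (w + axis l 1 \<in> D))"
    if "unit_edge w l \<in> box_edges m" for w l
    using that by (auto simp: edge_boundary_def) (auto simp: unit_edge_def)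
  show ?thesis
  proof (cases "\<exists>f\<in>?Q. f \<in> K")
    case True
    then have "g \<in> K \<longleftrightarrow> g \<in> edge_boundary m D" if "g \<in> ?Q" for g
      using all that boundary_component_subset [OF e] by (auto simp only: K_def)
    then have "unit_edge z i \<in> K \<longleftrightarrow> ((z \<in> D) \<noteq> (z + axis i 1 \<in> D))"
      "unit_edge z j \<in> K \<longleftrightarrow> ((z \<in> D) \<noteq> (z + axis j 1 \<in> D))"
      "unit_edge (z + axis j 1) i \<in> K \<longleftrightarrow> ((z + axis j 1 \<in> D) \<noteq> (z + axis j 1 + axis i 1 \<in> D))"
      "unit_edge (z + axis i 1) j \<in> K \<longleftrightarrow> ((z + axis i 1 \<in> D) \<noteq> (z + axis i 1 + axis j 1 \<in> D))"
      using bd box by auto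
    moreover have "z + axis i 1 + axis j 1 = z + axis j 1 + axis i 1" by simp
    ultimately show ?thesis by metis
  next
    case False
    then show ?thesis by blast
  qed
qed

lemma open_cluster_constant:
  assumes base: "\<And>x. x \<in> S \<Longrightarrow> x \<in> lattice_points \<Longrightarrow> \<not> A x"
    and step: "\<And>z j. unit_edge z j \<in> box_edges m \<Longrightarrow> \<omega> (unit_edge z j) \<Longrightarrow> A z \<longleftrightarrow> A (z + axis j 1)"
    and x: "x \<in> open_cluster m S \<omega>"
  shows "\<not> A x"
proof -
  obtain w where w: "w \<in> S" "w \<in> lattice_points" "(w, x) \<in> (open_steps m \<omega>)\<^sup>*"
    using x by (auto simp: open_cluster_def)
  from w(3) show ?thesis
  proof (induction rule: rtrancl_induct)
    case base
    show ?case using assms(1) w by blast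
  next
    case (step y z)
    then have yz: "{y, z} \<in> box_edges m" "\<omega> {y, z}" by (auto simp: open_steps_def)
    then obtain u j where u: "{y, z} = unit_edge u j" by (auto elim: box_edgesE)
    then have "A u \<longleftrightarrow> A (u + axis j 1)" using assms(2) yz by simp
    moreover have "y = u \<and> z = u + axis j 1 \<or> z = u \<and> y = u + axis j 1"
      using u by (auto simp: unit_edge_def doubleton_eq_iff)
    ultimately show ?case using step.IH by blast
  qed
qed

lemma edge_boundary_cluster_closed:
  assumes "f \<in> edge_boundary m (open_cluster m S \<omega>)"
  shows "\<not> \<omega> f"
proof
  assume "\<omega> f"
  obtain z i where z: "f = {z, z + axis i 1}"
    using assms unfolding edge_boundary_def unit_edge_def [symmetric] by (blast elim: box_edgesE)
  then have "(z, z + axis i 1) \<in> open_steps m \<omega>" "(z + axis i 1, z) \<in> open_steps m \<omega>"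
    using assms \<open>\<omega> f\<close> by (auto simp: edge_boundary_def open_steps_def insert_commute)
  then have "z \<in> open_cluster m S \<omega> \<longleftrightarrow> z + axis i 1 \<in> open_cluster m S \<omega>"
    using open_cluster_step by blast
  then show False using assms z by (auto simp: edge_boundary_def)
qed

text \<open>Otherwise the ray parity of the component of \<open>e\<close> is a primitive of this component. It vanishes on
  the top and bottom sides, because the horizontal rays from there stay in the side, where no edge
  belongs to the boundary of the bottom cluster; it is constant along open edges, because boundary
  edges are closed. So it vanishes at both ends of \<open>e\<close>, although \<open>e\<close> is in the component.\<close>

lemma boundary_component_reaches_face:
  fixes v i :: "'n::finite"
  assumes nc: "\<not> top_bottom_connected v m \<omega>" and piv: "e \<in> pivotal_edges v m \<omega>" and iv: "i \<noteq> v"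
  shows "\<exists>g\<in>boundary_component m (open_cluster m (bottom_side v m) \<omega>) e. \<forall>x\<in>g. x $ i = real m"
proof (rule ccontr)
  let ?C = "open_cluster m (top_side v m) \<omega>" and ?D = "open_cluster m (bottom_side v m) \<omega>"
  let ?K = "boundary_component m ?D e"
  assume neg: "\<not> ?thesis"
  have disj: "?C \<inter> ?D = {}"
    using nc top_bottom_connected_iff_clusters by blast
  have e: "e \<in> box_edges m" "e \<inter> ?C \<noteq> {}" "e \<inter> ?D \<noteq> {}"
    using piv pivotal_edges_iff [OF nc] by auto
  then have eb: "e \<in> edge_boundary m ?D"
    using disj by (auto simp: edge_boundary_def)
  have KD: "?K \<subseteq> edge_boundary m ?D"
    using boundary_component_subset [OF eb] .
  have K: "?K \<subseteq> box_edges m"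
    using KD by (auto simp: edge_boundary_def)
  have cob: "(ray_parity ?K i z \<noteq> ray_parity ?K i (z + axis j 1)) \<longleftrightarrow> unit_edge z j \<in> ?K"
    if "unit_edge z j \<in> box_edges m" for z j
  proof (rule ray_parity_coboundary [OF K _ _ that])
    show "\<exists>x\<in>g. x $ i \<noteq> real m" if "g \<in> ?K" for g using neg that by blast
  qed (use boundary_component_square [OF eb] in blast)
  \<comment> \<open>\<open>h\<close> is the height of the top or bottom side, and \<open>S\<close> the corresponding cluster.\<close>
  have ray: "\<not> ray_parity ?K i x"
    if "x $ v = h" "\<And>w. w \<in> box_of m \<Longrightarrow> w \<in> lattice_points \<Longrightarrow> w $ v = h \<Longrightarrow> w \<in> S"
      "S \<inter> ?D = {} \<or> S \<subseteq> ?D" for x h S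
  proof -
    have "unit_edge (x + real k *\<^sub>R axis i 1) i \<notin> ?K" for k
    proof
      let ?f = "unit_edge (x + real k *\<^sub>R axis i 1) i"
      assume f: "?f \<in> ?K"
      then have "?f \<subseteq> box_of m" "?f \<subseteq> lattice_points"
        using K box_edge_subset by blast+
      moreover have "w $ v = h" if "w \<in> ?f" for w
        using that \<open>x $ v = h\<close> iv by (auto simp: unit_edge_def axis_def)
      ultimately have "?f \<subseteq> S" using that(2) by blast
      moreover have "?f \<inter> ?D \<noteq> {}" "\<not> ?f \<subseteq> ?D"
        using f KD by (auto simp: edge_boundary_def)
      ultimately show False using that(3) by blast
    qed
    then show ?thesis by (simp add: ray_parity_def)
  qed
  have step: "ray_parity ?K i z \<longleftrightarrow> ray_parity ?K i (z + axis j 1)"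
    if "unit_edge z j \<in> box_edges m" "\<omega> (unit_edge z j)" for z j
    using cob [OF that(1)] that(2) KD edge_boundary_cluster_closed by blast
  have "\<not> ray_parity ?K i x" if "x \<in> ?C" for x
  proof (rule open_cluster_constant [OF _ step that])
    fix y assume "y \<in> top_side v m"
    then show "\<not> ray_parity ?K i y"
      using disj by (intro ray [of y "real m" ?C]) (auto simp: top_side_def intro!: open_cluster_base)
  qed
  moreover have "\<not> ray_parity ?K i x" if "x \<in> ?D" for x
  proof (rule open_cluster_constant [OF _ step that])
    fix y assume "y \<in> bottom_side v m"
    then show "\<not> ray_parity ?K i y"
      by (intro ray [of y "- real m" ?D]) (auto simp: bottom_side_def intro!: open_cluster_base)
  qed
  moreover obtain z j where z: "e = unit_edge z j" using e(1) by (rule box_edgesE)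
  ultimately have "\<not> ray_parity ?K i z" "\<not> ray_parity ?K i (z + axis j 1)"
    using e(2,3) disj unfolding unit_edge_def by blast+
  moreover have "unit_edge z j \<in> ?K"
    by (simp add: z boundary_component_def)
  ultimately show False using cob e(1) z by blast
qed

text \<open>Follow a shortest path in the boundary of the bottom cluster from \<open>e\<close> to a face. Its \<open>k\<close>-th edge
  has distance at most \<open>2 k\<close> from \<open>e\<close>. So the path needs at least \<open>n\<close> steps to come within distance
  1 of the complement of the box, and its first \<open>n\<close> edges are too close to \<open>e\<close> to be pivotal. A
  boundary edge of the bottom cluster that is not pivotal does not touch the top cluster.\<close>

lemma isolated_pivotal_closed_walk:
  fixes v i :: "'n::finite"
  assumes nc: "\<not> top_bottom_connected v m \<omega>" and piv: "e \<in> pivotal_edges v m \<omega>" and iv: "i \<noteq> v"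
    and R: "R \<le> isolation v m \<omega> e" and n: "4 * real n \<le> R"
  shows "\<exists>l\<in>walks (near_edges m) n e. closed_walk_off_cluster v m \<omega> l"
proof -
  let ?C = "open_cluster m (top_side v m) \<omega>" and ?D = "open_cluster m (bottom_side v m) \<omega>"
  have disj: "?C \<inter> ?D = {}"
    using nc top_bottom_connected_iff_clusters by blast
  have e: "e \<in> box_edges m" "e \<inter> ?C \<noteq> {}" "e \<inter> ?D \<noteq> {}"
    using piv pivotal_edges_iff [OF nc] by auto
  obtain x where x: "x \<in> e" using e by blast
  have far: "R \<le> dist x y" if "y \<in> - box_of m \<union> (\<Union>f \<in> pivotal_edges v m \<omega> - {e}. segment f)" for y
  proof -
    have "x \<in> segment e" using x by (simp add: segment_def hull_inc)
    then have "isolation v m \<omega> e \<le> dist x y"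
      unfolding isolation_def using that by (rule setdist_le_dist)
    then show ?thesis using R by simp
  qed
  obtain g where g: "(e, g) \<in> (boundary_steps m ?D)\<^sup>*" "\<And>y. y \<in> g \<Longrightarrow> y $ i = real m"
    using boundary_component_reaches_face [OF nc piv iv] by (auto simp: boundary_component_def)
  obtain N f where f0: "f 0 = e" and fN: "f N = g"
    and steps: "\<And>k. k < N \<Longrightarrow> (f k, f (Suc k)) \<in> boundary_steps m ?D" and inj: "inj_on f {..N}"
    using rtrancl_injective_path [OF g(1)] by metis
  have fb: "f k \<in> edge_boundary m ?D" if "0 < k" "k \<le> N" for k
    using steps [of "k - 1"] that by (auto simp: boundary_steps_def)
  have near: "f (Suc k) \<in> near_edges m (f k)" if "k < N" for k
    using steps [OF that] by (auto simp: boundary_steps_def)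
  \<comment> \<open>The extra 1 is needed only within \<open>e\<close>; the first step already bounds all distances by 2.\<close>
  have f_dist: "\<forall>y\<in>f k. dist x y \<le> 2 * real k + (if k = 0 then 1 else 0)" if "k \<le> N" for k
    using that
  proof (induction k)
    case 0
    then show ?case using dist_box_edge [OF e(1) x] f0 by simp
  next
    case (Suc k)
    show ?case
    proof (cases "k = 0")
      case True
      then show ?thesis using near [of 0] Suc.prems f0 x by (auto simp: near_edges_def)
    next
      case False
      then obtain w where w: "w \<in> f k"
        using fb [of k] Suc.prems by (auto simp: edge_boundary_def)
      have "dist x y \<le> 2 * real (Suc k)" if "y \<in> f (Suc k)" for y
      proof -
        have "dist w y \<le> 2"
          using near [of k] Suc.prems w that by (auto simp: near_edges_def)
        moreover have "dist x w \<le> 2 * real k"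
          using Suc.IH Suc.prems w False by auto
        ultimately show ?thesis using dist_triangle [of x y w] by simp
      qed
      then show ?thesis by simp
    qed
  qed
  have "n \<le> N"
  proof -
    have "g \<noteq> {}"
      using fb [of N] fN f0 x by (cases "N = 0") (auto simp: edge_boundary_def)
    then obtain y where y: "y \<in> g" by blast
    \<comment> \<open>A step of length 1 from the face leads out of the box.\<close>
    have "y + axis i 1 \<notin> box_of m"
      using g(2) [OF y] by (auto simp: mem_box_of axis_def intro!: exI [of _ i])
    then have "R \<le> dist x (y + axis i 1)" using far by blast
    also have "\<dots> \<le> dist x y + 1"
      using dist_triangle [of x "y + axis i 1" y] by (simp add: dist_norm)
    also have "dist x y \<le> 2 * real N + (if N = 0 then 1 else 0)"
      using f_dist [of N] fN y by simp
    finally have "4 * real n \<le> 2 * real N + 2"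
      using n by (simp split: if_splits)
    then have "2 * n \<le> N + 1" by linarith
    then show ?thesis by linarith
  qed
  let ?l = "map (\<lambda>k. f (Suc k)) [0..<n]"
  have "?l \<in> walks (near_edges m) n e"
    using walks_of_sequence [of n f "near_edges m"] near \<open>n \<le> N\<close> f0 by simp
  moreover have "distinct ?l"
  proof -
    have "inj_on (f \<circ> Suc) {..<n}"
      using \<open>n \<le> N\<close> by (intro comp_inj_on inj_on_subset [OF inj]) auto
    then show ?thesis by (simp add: distinct_map o_def atLeast0LessThan)
  qed
  moreover have "\<not> \<omega> h \<and> h \<inter> ?C = {}" if h: "h \<in> set ?l" for h
  proof -
    obtain k' where "h = f (Suc k')" "k' < n" using h by auto
    then obtain k where k: "h = f k" "0 < k" "k \<le> n"
      by (intro that [of "Suc k'"]) auto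
    then have hb: "h \<in> edge_boundary m ?D" using fb \<open>n \<le> N\<close> by simp
    have "h \<inter> ?C = {}"
    proof (rule ccontr)
      assume "h \<inter> ?C \<noteq> {}"
      then have "h \<in> pivotal_edges v m \<omega>"
        using hb pivotal_edges_iff [OF nc] by (auto simp: edge_boundary_def)
      moreover have "h \<noteq> e"
        using inj_onD [OF inj, of k 0] k \<open>n \<le> N\<close> f0 by auto
      moreover obtain y where y: "y \<in> h" using hb by (auto simp: edge_boundary_def)
      then have "y \<in> segment h" by (simp add: segment_def hull_inc)
      ultimately have "R \<le> dist x y" using far by blast
      also have "\<dots> \<le> 2 * real k" using f_dist [of k] k y \<open>n \<le> N\<close> by simp
      finally show False using n k by simp
    qed
    then show ?thesis using edge_boundary_cluster_closed hb by blast
  qed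
  ultimately show ?thesis unfolding closed_walk_off_cluster_def by blast
qed

section \<open>The probability estimate\<close>

text \<open>With \<open>n = \<lfloor>4 c ln N\<rfloor>\<close> the power of \<open>q\<close> is at most \<open>exp 1 * N powr (- 4 * c)\<close>. The assumption on \<open>N\<close>
  gives \<open>d exp 1 \<le> N\<close>, so the prefactors cost at most \<open>N\<^sup>2\<close>, and \<open>2 - 4 c \<le> - c\<close>.\<close>

lemma walk_bound_le_powr:
  fixes q c N :: real
  assumes q: "0 \<le> q" "q \<le> exp (- 1)" and c: "1 \<le> c" and N: "3 ^ (6 * d) < N"
  shows "N * real d * q ^ nat \<lfloor>4 * c * ln N\<rfloor> \<le> 1 / N powr c"
proof -
  let ?n = "nat \<lfloor>4 * c * ln N\<rfloor>"
  have N1: "1 < N" using N one_le_power [of "3 :: real" "6 * d"] by linarith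
  have lnN: "0 < ln N" using N1 by simp
  have "3 * real d \<le> 3 ^ (6 * d)"
  proof (cases "d = 0")
    case False
    have "real d \<le> 3 ^ d"
      using of_nat_less_two_power [of d, where 'a = real] power_mono [of "2 :: real" 3 d] by linarith
    also have "\<dots> \<le> 3 ^ (6 * d - 1)" using False by (intro power_increasing) auto
    finally have "3 * real d \<le> 3 * 3 ^ (6 * d - 1)" by simp
    also have "\<dots> = 3 ^ (6 * d)" using False by (simp flip: power_Suc)
    finally show ?thesis .
  qed simp
  then have dN: "real d * exp 1 \<le> N"
    using N exp_le mult_left_mono [of "exp 1" "3 :: real" "real d"] by simp
  have "4 * c * ln N - 1 \<le> real ?n"
    using c lnN by linarith
  then have "exp (- real ?n) \<le> exp (1 - 4 * c * ln N)" by simp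
  moreover have "q ^ ?n \<le> exp (- 1) ^ ?n" using q by (intro power_mono) auto
  moreover have "exp (- 1) ^ ?n = exp (- real ?n)"
    by (simp flip: exp_of_nat_mult)
  ultimately have "q ^ ?n \<le> exp (1 - 4 * c * ln N)" by linarith
  also have "\<dots> = exp 1 * N powr (- 4 * c)"
    using N1 by (simp add: powr_def exp_diff exp_minus field_simps)
  finally have "N * real d * q ^ ?n \<le> N * real d * (exp 1 * N powr (- 4 * c))"
    using N1 by (intro mult_left_mono) auto
  also have "\<dots> = N * N powr (- 4 * c) * (real d * exp 1)" by simp
  also have "\<dots> \<le> N * N powr (- 4 * c) * N"
    using dN N1 by (intro mult_left_mono) auto
  also have "\<dots> = N powr (2 - 4 * c)"
    using N1 by (simp add: powr_diff powr_minus powr_numeral power2_eq_square field_simps)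
  also have "\<dots> \<le> N powr (- c)" using N1 c by (intro powr_mono) auto
  finally show ?thesis by (simp add: powr_minus_divide)
qed

theorem proposition1p4:
  assumes "CARD('n::finite) \<ge> 2"
  shows "\<exists>(pt::real) (\<kappa>::real). pt < 1 \<and> \<kappa> > 1 \<and>
    (\<forall>(v::'n) (p::real) (c::real) (m::nat).
       0 < p \<longrightarrow> pt \<le> p \<longrightarrow> p < 1 \<longrightarrow> c \<ge> 1 \<longrightarrow> m \<ge> 1 \<longrightarrow>
       box_card TYPE('n) m > 3 ^ (6 * CARD('n)) \<longrightarrow>
       cond_prob (percolation m p)
         (\<lambda>\<omega>. \<exists>e \<in> pivotal_edges v m \<omega>. isolation v m \<omega> e \<ge> \<kappa> * c * ln (real (box_card TYPE('n) m)))
         (\<lambda>\<omega>. \<not> top_bottom_connected v m \<omega>)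
       \<le> 1 / real (box_card TYPE('n) m) powr c)"
proof -
  let ?M = "real (near_edges_bound TYPE('n))"
  \<comment> \<open>Chosen so that \<open>?M * (1 - p) \<le> exp (- 1)\<close> for \<open>p \<ge> pt\<close>; adding 1 keeps the denominator positive.\<close>
  define pt where "pt = 1 - exp (- 1) / (1 + ?M)"
  have "cond_prob (percolation m p)
         (\<lambda>\<omega>. \<exists>e \<in> pivotal_edges v m \<omega>. isolation v m \<omega> e \<ge> 16 * c * ln (real (box_card TYPE('n) m)))
         (\<lambda>\<omega>. \<not> top_bottom_connected v m \<omega>)
       \<le> 1 / real (box_card TYPE('n) m) powr c"
    if p: "0 < p" "pt \<le> p" "p < 1" and c: "c \<ge> 1" and N: "box_card TYPE('n) m > 3 ^ (6 * CARD('n))"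
    for v :: 'n and p c :: real and m
  proof -
    let ?N = "real (box_card TYPE('n) m)"
    let ?R = "16 * c * ln ?N"
    let ?prob = "measure (percolation m p :: 'n configuration measure)"
    let ?nc = "{\<omega>. \<not> top_bottom_connected v m \<omega>}"
    let ?iso = "\<lambda>\<omega>. \<exists>e \<in> pivotal_edges v m \<omega>. isolation v m \<omega> e \<ge> ?R"
    define n where "n = nat \<lfloor>4 * c * ln ?N\<rfloor>"
    have N': "3 ^ (6 * CARD('n)) < ?N"
      using N by (metis of_nat_less_iff of_nat_numeral of_nat_power)
    have "1 < ?N" using N' one_le_power [of "3 :: real" "6 * CARD('n)"] by linarith
    then have "0 \<le> 4 * c * ln ?N"
      using c by simp
    then have "real n \<le> 4 * c * ln ?N"
      unfolding n_def by (rule of_nat_floor)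
    then have n: "4 * real n \<le> ?R" by simp
    obtain i where i: "i \<noteq> v"
    proof -
      have "\<not> (UNIV :: 'n set) \<subseteq> {v}"
        using card_mono [of "{v}" "UNIV :: 'n set"] assms by auto
      then show ?thesis using that by blast
    qed
    have "{\<omega>. ?iso \<omega> \<and> \<not> top_bottom_connected v m \<omega>} \<subseteq> {\<omega>. \<not> top_bottom_connected v m \<omega> \<and>
        (\<exists>e\<in>box_edges m. \<exists>l\<in>walks (near_edges m) n e. closed_walk_off_cluster v m \<omega> l)}"
      using isolated_pivotal_closed_walk [OF _ _ i _ n] by (fastforce simp: pivotal_edges_def)
    then have "?prob {\<omega>. ?iso \<omega> \<and> \<not> top_bottom_connected v m \<omega>} \<le> ?prob {\<omega>. \<not> top_bottom_connected v m \<omega> \<and>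
        (\<exists>e\<in>box_edges m. \<exists>l\<in>walks (near_edges m) n e. closed_walk_off_cluster v m \<omega> l)}"
      unfolding percolation_def by (intro measure_pmf.finite_measure_mono) auto
    also have "\<dots> \<le> ?N * real CARD('n) * (?M * (1 - p)) ^ n * ?prob ?nc"
      using prob_ex_closed_walk [of p m v n] p by simp
    also have "\<dots> \<le> 1 / ?N powr c * ?prob ?nc"
    proof -
      have "?M * (1 - p) \<le> (1 + ?M) * (1 - p)" using p by simp
      also have "\<dots> \<le> (1 + ?M) * (exp (- 1) / (1 + ?M))"
        using p unfolding pt_def by (intro mult_left_mono) auto
      finally have "?M * (1 - p) \<le> exp (- 1)" by simp
      then show ?thesis
        unfolding n_def using p c N' by (intro mult_right_mono walk_bound_le_powr) auto
    qed
    finally have le: "?prob {\<omega>. ?iso \<omega> \<and> \<not> top_bottom_connected v m \<omega>} \<le> 1 / ?N powr c * ?prob ?nc" .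
    have "cond_prob (percolation m p) ?iso (\<lambda>\<omega>. \<not> top_bottom_connected v m \<omega>) =
        ?prob {\<omega>. ?iso \<omega> \<and> \<not> top_bottom_connected v m \<omega>} / ?prob ?nc"
      by (simp add: cond_prob_def percolation_def)
    also have "\<dots> \<le> 1 / ?N powr c"
    proof (cases "?prob ?nc = 0")
      case False
      then have "0 < ?prob ?nc" by (simp add: zero_less_measure_iff)
      then show ?thesis using le by (simp add: divide_le_eq)
    qed simp
    finally show ?thesis .
  qed
  moreover have "pt < 1" unfolding pt_def by (simp add: add_pos_nonneg)
  ultimately show ?thesis
    by (intro exI [of _ pt] exI [of _ 16]) auto
qed

end
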